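(* Let $A\in\mathrm{GL}(n)$. Then there exist a unique $Q\in\mathrm{O}(n)$ and a unique upper triangular matrix $R$ with positive diagonal entries such that $A=QR$.
   Context: $\mathrm{GL}(n)$ is the group of invertible real $n\times n$ matrices and $\mathrm{O}(n)$ the orthogonal group. *)

theory Defs
  imports Complex_Main "Jordan_Normal_Form.Matrix"
begin

definition GL :: "nat \<Rightarrow> real mat set" where
  "GL n = {A \<in> carrier_mat n n. invertible_mat A}"

(* The library predicate orthogonal_mat only asks the columns to be nonzero and
   pairwise orthogonal, not normalized, so it does not describe O(n). *)
definition O_group :: "nat \<Rightarrow> real mat set" where
  "O_group n = {Q \<in> carrier_mat n n.
     transpose_mat Q * Q = 1\<^sub>m n \<and> Q * transpose_mat Q = 1\<^sub>m n}"

end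

theory Submission
  imports Defs "Jordan_Normal_Form.Determinant"
begin

text \<open>Existence is Gram-Schmidt, carried out as right multiplication by triangular matrices: one
  finds a triangular T such that Q = A T has orthonormal columns, and then R is the transpose of Q
  times A. Both the triangularity of this R and uniqueness rest on the fact that M is upper
  triangular with positive diagonal as soon as R and M R are: applied to an orthogonal M and to
  its transpose, it forces M to be diagonal with entries 1.\<close>

section \<open>Upper triangular matrices with positive diagonal\<close>

definition pos_upper :: "nat \<Rightarrow> real mat set" where
  "pos_upper n = {R \<in> carrier_mat n n. upper_triangular R \<and> (\<forall>i<n. R $$ (i, i) > 0)}"

lemma pos_upperI:
  assumes "R \<in> carrier_mat n n"
    and "\<And>i j. j < i \<Longrightarrow> i < n \<Longrightarrow> R $$ (i, j) = 0"
    and "\<And>i. i < n \<Longrightarrow> R $$ (i, i) > 0"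
  shows "R \<in> pos_upper n"
  using assms by (auto simp: pos_upper_def)

lemma pos_upperD:
  assumes "R \<in> pos_upper n"
  shows "R \<in> carrier_mat n n"
    and "\<And>i j. j < i \<Longrightarrow> i < n \<Longrightarrow> R $$ (i, j) = 0"
    and "\<And>i. i < n \<Longrightarrow> R $$ (i, i) > 0"
  using assms by (auto simp: pos_upper_def)

lemma pos_upper_one: "1\<^sub>m n \<in> pos_upper n"
  by (rule pos_upperI) auto

lemma det_pos_upper_nonzero:
  assumes "R \<in> pos_upper n"
  shows "det R \<noteq> 0"
  using upper_triangular_imp_det_eq_0_iff[of R n] pos_upperD(1,3)[OF assms] assms
  by (fastforce simp: pos_upper_def diag_mat_def)

lemma mult_mat_entry:
  assumes "A \<in> carrier_mat n m" "B \<in> carrier_mat m p" "i < n" "j < p"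
  shows "(A * B) $$ (i, j) = (\<Sum>k<m. A $$ (i, k) * B $$ (k, j))"
  using assms by (auto simp: scalar_prod_def lessThan_atLeast0 intro!: sum.cong)

lemma mult_mat_entry_single:
  assumes "A \<in> carrier_mat n m" "B \<in> carrier_mat m p" "i < n" "j < p" "l < m"
    and zero: "\<And>k. k < m \<Longrightarrow> k \<noteq> l \<Longrightarrow> A $$ (i, k) * B $$ (k, j) = 0"
  shows "(A * B) $$ (i, j) = A $$ (i, l) * B $$ (l, j)"
proof -
  have "(\<Sum>k<m. A $$ (i, k) * B $$ (k, j)) = (\<Sum>k\<in>{l}. A $$ (i, k) * B $$ (k, j))"
    using zero \<open>l < m\<close> by (intro sum.mono_neutral_right) auto
  then show ?thesis
    using mult_mat_entry[OF assms(1-4)] by simp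
qed

text \<open>In the sum for entry \<open>(i, j)\<close>, a term can be nonzero only if
  \<open>i \<le> k \<le> j\<close>. No such \<open>k\<close> exists below the diagonal, and only
  \<open>k = i\<close> on it.\<close>

lemma pos_upper_mult:
  assumes R: "R \<in> pos_upper n" and S: "S \<in> pos_upper n"
  shows "R * S \<in> pos_upper n"
proof (rule pos_upperI)
  note r = pos_upperD[OF R] and s = pos_upperD[OF S]
  show "R * S \<in> carrier_mat n n"
    using r(1) s(1) by simp
  show "(R * S) $$ (i, j) = 0" if "j < i" "i < n" for i j
  proof -
    have "R $$ (i, k) * S $$ (k, j) = 0" if "k < n" for k
      using r(2)[of k i] s(2)[of j k] \<open>j < i\<close> \<open>i < n\<close> that by (cases "k < i") auto
    then show ?thesis
      \<comment> \<open>Deleting \<open>mult_eq_0_iff\<close> keeps the vanishing of each term as an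
        equation about a product, so that it rewrites the summands.\<close>
      using mult_mat_entry[OF r(1) s(1), of i j] that by (simp del: mult_eq_0_iff)
  qed
  show "(R * S) $$ (i, i) > 0" if "i < n" for i
  proof -
    have "R $$ (i, k) * S $$ (k, i) = 0" if "k < n" "k \<noteq> i" for k
      using r(2)[of k i] s(2)[of i k] \<open>i < n\<close> that by (cases k i rule: linorder_cases) auto
    then have "(R * S) $$ (i, i) = R $$ (i, i) * S $$ (i, i)"
      using that by (intro mult_mat_entry_single[OF r(1) s(1)])
    then show ?thesis
      using r(3) s(3) that by simp
  qed
qed

text \<open>This does the work of inverting \<open>R\<close> without constructing an inverse. Column
  \<open>j\<close> of \<open>R\<close> stops at row \<open>j\<close>, so once row \<open>i\<close>
  of \<open>M\<close> vanishes left of \<open>j\<close>, entry \<open>(i, j)\<close> of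
  \<open>M * R\<close> is \<open>M $$ (i, j) * R $$ (j, j)\<close>. The factor
  \<open>R $$ (j, j)\<close> is positive, so zeros and signs pass from \<open>M * R\<close> to
  \<open>M\<close>, column by column from the left.\<close>

lemma pos_upper_cancel_right:
  assumes M: "M \<in> carrier_mat n n" and R: "R \<in> pos_upper n" and MR: "M * R \<in> pos_upper n"
  shows "M \<in> pos_upper n"
proof -
  note r = pos_upperD[OF R] and s = pos_upperD[OF MR]
  have entry: "(M * R) $$ (i, j) = M $$ (i, j) * R $$ (j, j)"
    if "i < n" "j < n" and zero: "\<And>k. k < j \<Longrightarrow> M $$ (i, k) = 0" for i j
  proof -
    have "M $$ (i, k) * R $$ (k, j) = 0" if "k < n" "k \<noteq> j" for k
      using zero r(2)[of j k] that by (cases k j rule: linorder_cases) auto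
    then show ?thesis
      using that(1,2) by (intro mult_mat_entry_single[OF M r(1)])
  qed
  have lower: "M $$ (i, j) = 0" if "j < i" "i < n" for i j
    using that(1)
  proof (induction j rule: less_induct)
    case (less j)
    then have "(M * R) $$ (i, j) = M $$ (i, j) * R $$ (j, j)"
      using that(2) by (intro entry) auto
    then show ?case
      using s(2)[of j i] r(3)[of j] less.prems that(2) by simp
  qed
  have "M $$ (i, i) > 0" if "i < n" for i
    using entry[of i i] lower[of _ i] s(3)[OF that] r(3)[OF that] that
    by (simp add: zero_less_mult_iff)
  with M lower show ?thesis
    by (intro pos_upperI)
qed

text \<open>Cancelling \<open>M\<close> from the identity makes its transpose upper triangular too,
  hence \<open>M\<close> is diagonal. Its diagonal entries are positive with square 1.\<close>

lemma orthogonal_pos_upper_eq_one: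
  assumes M: "M \<in> pos_upper n" and orth: "transpose_mat M * M = 1\<^sub>m n"
  shows "M = 1\<^sub>m n"
proof -
  note m = pos_upperD[OF M]
  have "transpose_mat M \<in> pos_upper n"
    using pos_upper_cancel_right[OF _ M] m(1) orth pos_upper_one by simp
  then have upper: "M $$ (i, j) = 0" if "i < j" "j < n" for i j
    using pos_upperD(2)[of _ n i j] that m(1) by fastforce
  have diag: "M $$ (i, i) = 1" if "i < n" for i
  proof -
    have "M $$ (k, i) = 0" if "k < n" "k \<noteq> i" for k
      using upper[of k i] m(2)[of i k] \<open>i < n\<close> that by (cases k i rule: linorder_cases) auto
    then have "(transpose_mat M * M) $$ (i, i) = (M $$ (i, i))\<^sup>2"
      using mult_mat_entry_single[of "transpose_mat M" n n M n i i i] m(1) that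
      by (simp add: power2_eq_square)
    then show ?thesis
      using orth that m(3)[OF that] by (simp add: power2_eq_1_iff)
  qed
  show ?thesis
  proof (rule eq_matI)
    fix i j assume "i < dim_row (1\<^sub>m n :: real mat)" "j < dim_col (1\<^sub>m n :: real mat)"
    then show "M $$ (i, j) = 1\<^sub>m n $$ (i, j)"
      using upper[of i j] m(2)[of j i] diag[of i] by (cases i j rule: linorder_cases) auto
  qed (use m(1) in auto)
qed

section \<open>Gram-Schmidt by right multiplication\<close>

text \<open>The column is the image of a nonzero unit vector under an injective map. Positivity
  justifies the divisions in Gram-Schmidt.\<close>

lemma col_scalar_prod_self_pos:
  fixes B :: "real mat"
  assumes B: "B \<in> carrier_mat n n" and det: "det B \<noteq> 0" and "k < n"
  shows "col B k \<bullet> col B k > 0"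
proof -
  have "B *\<^sub>v unit_vec n k = col B k"
    using B \<open>k < n\<close> by (intro eq_vecI) auto
  moreover have "unit_vec n k \<noteq> (0\<^sub>v n :: real vec)"
    using \<open>k < n\<close> by (simp add: unit_vec_def zero_vec_def vec_eq_iff)
  ultimately have "col B k \<noteq> 0\<^sub>v n"
    using det det_0_iff_vec_prod_zero_field[OF B] unit_vec_carrier[of n k] by metis
  then obtain i where i: "i < n" "col B k $ i \<noteq> 0"
    using B eq_vecI[of "0\<^sub>v n" "col B k"] by fastforce
  have "(\<Sum>j\<in>{0..<n}. col B k $ j * col B k $ j) > 0"
    by (rule sum_pos2[of _ i]) (use i in \<open>auto simp: zero_less_mult_iff\<close>)
  then show ?thesis
    using B by (simp add: scalar_prod_def)
qed

text \<open>Right multiplication by \<open>E\<close> subtracts from column \<open>k\<close> its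
  projections onto the earlier columns and leaves those earlier columns alone.\<close>

lemma gram_schmidt_step:
  fixes B :: "real mat"
  assumes B: "B \<in> carrier_mat n n" and det: "det B \<noteq> 0" and k: "k < n"
    and orth: "\<And>i j. i < j \<Longrightarrow> j < k \<Longrightarrow> col B i \<bullet> col B j = 0"
  shows "\<exists>E \<in> pos_upper n. \<forall>j < Suc k. \<forall>i < j. col (B * E) i \<bullet> col (B * E) j = 0"
proof -
  \<comment> \<open>\<open>c i\<close> is the coefficient of the projection of column
    \<open>k\<close> onto column \<open>i\<close>.\<close>
  define c where "c i = (col B i \<bullet> col B k) / (col B i \<bullet> col B i)" for i
  define E where "E = mat n n (\<lambda>(i, j). if i = j then 1 else if j = k \<and> i < k then - c i else 0)"
  have E: "E \<in> pos_upper n"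
    by (rule pos_upperI) (auto simp: E_def)
  note e = pos_upperD(1)[OF E]
  have same: "col (B * E) j = col B j" if "j < k" for j
  proof (rule eq_vecI)
    fix r assume "r < dim_vec (col B j)"
    then have r: "r < n" using B by simp
    have "(B * E) $$ (r, j) = B $$ (r, j) * E $$ (j, j)"
      using r that k by (intro mult_mat_entry_single[OF B e]) (auto simp: E_def)
    also have "\<dots> = B $$ (r, j)"
      using that k by (simp add: E_def)
    finally show "col (B * E) j $ r = col B j $ r"
      using B e r that k by simp
  qed (use B e in simp)
  have new: "col B i \<bullet> col (B * E) k = 0" if "i < k" for i
  proof -
    let ?G = "transpose_mat B * B"
    have G: "?G $$ (i, l) = col B i \<bullet> col B l" if "l < n" for l
      using B that \<open>i < k\<close> k by simp
    have sym: "col B i \<bullet> col B l = col B l \<bullet> col B i" for l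
      using B by (intro comm_scalar_prod[of _ n]) auto
    have pos: "col B i \<bullet> col B i > 0"
      using col_scalar_prod_self_pos[OF B det] that k by simp
    \<comment> \<open>Two terms survive: \<open>l = k\<close> gives the old scalar product and
      \<open>l = i\<close> gives its negative, by the choice of \<open>c\<close>. The others vanish
      by orthogonality for \<open>l < k\<close> and by the shape of \<open>E\<close> for
      \<open>l > k\<close>. Writing both with \<open>if\<close> lets the sum collapse to 0.\<close>
    have summand: "?G $$ (i, l) * E $$ (l, k) =
        (if l = k then col B i \<bullet> col B k else 0) + (if l = i then - (col B i \<bullet> col B k) else 0)"
      if "l < n" for l
    proof -
      consider "l = k" | "l = i" | "l < k" "l \<noteq> i" | "l > k" by linarith
      then show ?thesis
      proof cases
        case 3
        then have "col B i \<bullet> col B l = 0"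
          using orth[of i l] orth[of l i] sym[of l] \<open>i < k\<close> by (metis nat_neq_iff)
        with 3 show ?thesis using G[OF that] by simp
      qed (use G[OF that] that k \<open>i < k\<close> pos in \<open>auto simp: E_def c_def\<close>)
    qed
    have "col B i \<bullet> col (B * E) k = (transpose_mat B * (B * E)) $$ (i, k)"
      using B e that k by simp
    also have "\<dots> = (?G * E) $$ (i, k)"
      using B e by (simp add: assoc_mult_mat[of _ n n _ n _ n])
    also have "\<dots> = (\<Sum>l<n. ?G $$ (i, l) * E $$ (l, k))"
      using B e that k by (intro mult_mat_entry[of _ n n _ n]) auto
    also have "\<dots> = 0"
      using that k by (simp add: summand sum.distrib)
    finally show ?thesis .
  qed
  have "col (B * E) i \<bullet> col (B * E) j = 0" if "i < j" "j < Suc k" for i j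
    using that orth[of i j] same[of i] same[of j] new[of i] by (cases "j = k") auto
  with E show ?thesis by blast
qed

text \<open>The matrices \<open>E\<close> of the successive steps are accumulated in
  \<open>T\<close>. Each step applies because the determinant stays nonzero.\<close>

lemma gram_schmidt_orthogonal:
  fixes A :: "real mat"
  assumes A: "A \<in> carrier_mat n n" and det: "det A \<noteq> 0" and "k \<le> n"
  shows "\<exists>T \<in> pos_upper n. \<forall>j < k. \<forall>i < j. col (A * T) i \<bullet> col (A * T) j = 0"
  using \<open>k \<le> n\<close>
proof (induction k)
  case 0
  show ?case using pos_upper_one by blast
next
  case (Suc k)
  then obtain T where T: "T \<in> pos_upper n"
    and orth: "\<And>i j. i < j \<Longrightarrow> j < k \<Longrightarrow> col (A * T) i \<bullet> col (A * T) j = 0"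
    by auto
  note t = pos_upperD(1)[OF T]
  have "det (A * T) \<noteq> 0"
    using det det_pos_upper_nonzero[OF T] det_mult[OF A t] by simp
  then obtain E where E: "E \<in> pos_upper n"
    and "\<forall>j < Suc k. \<forall>i < j. col (A * T * E) i \<bullet> col (A * T * E) j = 0"
    using gram_schmidt_step[of "A * T" n k] A t orth Suc.prems by auto
  moreover have "A * T * E = A * (T * E)"
    using A t pos_upperD(1)[OF E] by simp
  ultimately show ?case
    using pos_upper_mult[OF T E] by auto
qed

text \<open>Once the columns are orthogonal, a positive diagonal matrix \<open>D\<close> rescales
  them to length 1, and \<open>T * D\<close> remains triangular.\<close>

lemma gram_schmidt_orthonormal:
  fixes A :: "real mat"
  assumes A: "A \<in> carrier_mat n n" and det: "det A \<noteq> 0"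
  shows "\<exists>T \<in> pos_upper n. transpose_mat (A * T) * (A * T) = 1\<^sub>m n"
proof -
  obtain T where T: "T \<in> pos_upper n"
    and orth: "\<And>i j. i < j \<Longrightarrow> j < n \<Longrightarrow> col (A * T) i \<bullet> col (A * T) j = 0"
    using gram_schmidt_orthogonal[OF A det order_refl] by auto
  define B where "B = A * T"
  note t = pos_upperD(1)[OF T]
  have B: "B \<in> carrier_mat n n"
    using A t by (simp add: B_def)
  have "det B \<noteq> 0"
    using det det_pos_upper_nonzero[OF T] det_mult[OF A t] by (simp add: B_def)
  note pos = col_scalar_prod_self_pos[OF B this]
  have off: "col B i \<bullet> col B j = 0" if "i \<noteq> j" "i < n" "j < n" for i j
  proof -
    have "col B i \<bullet> col B j = col B j \<bullet> col B i"
      using B by (intro comm_scalar_prod[of _ n]) auto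
    then show ?thesis
      using orth[of i j] orth[of j i] that by (cases i j rule: linorder_cases) (auto simp: B_def)
  qed
  define s where "s j = 1 / sqrt (col B j \<bullet> col B j)" for j
  define D where "D = mat n n (\<lambda>(i, j). if i = j then s j else 0)"
  have D: "D \<in> pos_upper n"
    by (rule pos_upperI) (use pos in \<open>auto simp: D_def s_def\<close>)
  note d = pos_upperD(1)[OF D]
  have col: "col (B * D) j = s j \<cdot>\<^sub>v col B j" if "j < n" for j
  proof (rule eq_vecI)
    fix r assume "r < dim_vec (s j \<cdot>\<^sub>v col B j)"
    then have r: "r < n" using B by simp
    have "(B * D) $$ (r, j) = B $$ (r, j) * D $$ (j, j)"
      using r that by (intro mult_mat_entry_single[OF B d]) (auto simp: D_def)
    also have "\<dots> = s j * B $$ (r, j)"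
      using that by (simp add: D_def)
    finally show "col (B * D) j $ r = (s j \<cdot>\<^sub>v col B j) $ r"
      using B d r that by simp
  qed (use B d in simp)
  have "transpose_mat (B * D) * (B * D) = 1\<^sub>m n"
  proof (rule eq_matI)
    fix i j assume "i < dim_row (1\<^sub>m n :: real mat)" "j < dim_col (1\<^sub>m n :: real mat)"
    then have ij: "i < n" "j < n" by auto
    have "(transpose_mat (B * D) * (B * D)) $$ (i, j) = s i * s j * (col B i \<bullet> col B j)"
      using B d ij col[of i] col[of j] by simp
    also have "\<dots> = 1\<^sub>m n $$ (i, j)"
      using off[of i j] pos[of i] ij by (auto simp: s_def)
    finally show "(transpose_mat (B * D) * (B * D)) $$ (i, j) = 1\<^sub>m n $$ (i, j)" .
  qed (use B d in auto)
  moreover have "B * D = A * (T * D)"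
    using A t d by (simp add: B_def)
  ultimately show ?thesis
    using pos_upper_mult[OF T D] by auto
qed

section \<open>Existence and uniqueness of the factorization\<close>

lemma GL_det_nonzero:
  assumes "A \<in> GL n"
  shows "A \<in> carrier_mat n n" and "det A \<noteq> 0"
proof -
  show A: "A \<in> carrier_mat n n"
    using assms by (simp add: GL_def)
  obtain X where AX: "A * X = 1\<^sub>m n" and XA: "X * A = 1\<^sub>m (dim_row X)"
    using assms by (auto simp: GL_def invertible_mat_def inverts_mat_def)
  \<comment> \<open>The definition of invertibility does not fix the size of \<open>X\<close>;
    comparing column counts in the two products does.\<close>
  have "X \<in> carrier_mat n n"
    using arg_cong[OF AX, of dim_col] arg_cong[OF XA, of dim_col] A by auto
  then show "det A \<noteq> 0"
    using det_mult[OF A, of X] AX by auto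
qed

text \<open>With \<open>Q = A * T\<close>, the factor \<open>transpose_mat Q * A\<close> is a left
  inverse of \<open>T\<close>, so cancelling \<open>T\<close> from the identity shows it triangular
  with positive diagonal.\<close>

lemma QR_exists:
  assumes "A \<in> GL n"
  shows "\<exists>Q R. Q \<in> O_group n \<and> R \<in> pos_upper n \<and> A = Q * R"
proof -
  note A = GL_det_nonzero[OF assms]
  obtain T where T: "T \<in> pos_upper n" and orth: "transpose_mat (A * T) * (A * T) = 1\<^sub>m n"
    using gram_schmidt_orthonormal[OF A] by blast
  define Q where "Q = A * T"
  note t = pos_upperD(1)[OF T]
  have Q: "Q \<in> carrier_mat n n" and left: "transpose_mat Q * Q = 1\<^sub>m n"
    using A(1) t orth by (auto simp: Q_def)
  have right: "Q * transpose_mat Q = 1\<^sub>m n"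
    using mat_mult_left_right_inverse[OF _ Q left] Q by simp
  have "transpose_mat Q * A * T = 1\<^sub>m n"
    using left Q A(1) t assoc_mult_mat[of "transpose_mat Q" n n A n T n]
    by (simp add: Q_def[symmetric])
  then have "transpose_mat Q * A \<in> pos_upper n"
    using pos_upper_cancel_right[OF _ T, of "transpose_mat Q * A"] Q A(1) pos_upper_one by simp
  moreover have "A = Q * (transpose_mat Q * A)"
    using right Q A(1) assoc_mult_mat[of Q n n "transpose_mat Q" n A n] by simp
  ultimately show ?thesis
    using Q left right by (auto simp: O_group_def)
qed

text \<open>The orthogonal matrix \<open>M = transpose_mat Q' * Q\<close> carries \<open>R\<close>
  to \<open>R'\<close>, so cancellation makes it triangular with positive diagonal, hence the
  identity.\<close>

lemma QR_unique:
  assumes "Q \<in> O_group n" "R \<in> pos_upper n" "Q' \<in> O_group n" "R' \<in> pos_upper n"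
    and eq: "Q * R = Q' * R'"
  shows "Q = Q'" and "R = R'"
proof -
  have Q: "Q \<in> carrier_mat n n" "transpose_mat Q * Q = 1\<^sub>m n"
    and Q': "Q' \<in> carrier_mat n n" "transpose_mat Q' * Q' = 1\<^sub>m n" "Q' * transpose_mat Q' = 1\<^sub>m n"
    using assms(1,3) by (auto simp: O_group_def)
  note r = pos_upperD(1)[OF assms(2)] and r' = pos_upperD(1)[OF assms(4)]
  define M where "M = transpose_mat Q' * Q"
  have M: "M \<in> carrier_mat n n"
    using Q Q' by (simp add: M_def)
  have QM: "Q' * M = Q"
    using Q Q' assoc_mult_mat[of Q' n n "transpose_mat Q'" n Q n] by (simp add: M_def)
  have "M * R = transpose_mat Q' * (Q' * R')"
    using Q Q' r eq by (simp add: M_def)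
  also have "\<dots> = R'"
    using Q' r' assoc_mult_mat[of "transpose_mat Q'" n n Q' n R' n] by simp
  finally have MR: "M * R = R'" .
  then have upper: "M \<in> pos_upper n"
    using pos_upper_cancel_right[OF M assms(2)] assms(4) by simp
  have "transpose_mat M * M = transpose_mat Q * Q' * M"
    using Q Q' by (simp add: M_def transpose_mult[of _ n n])
  also have "\<dots> = 1\<^sub>m n"
    using Q Q' M QM by simp
  finally have "M = 1\<^sub>m n"
    by (rule orthogonal_pos_upper_eq_one[OF upper])
  with QM MR Q' r show "Q = Q'" and "R = R'"
    by auto
qed

theorem theorem3p9:
  fixes n :: nat and A :: "real mat"
  assumes "A \<in> GL n"
  shows "\<exists>!(Q, R). Q \<in> O_group n \<and>
           R \<in> carrier_mat n n \<and> upper_triangular R \<and> (\<forall>i<n. R $$ (i, i) > 0) \<and>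
           A = Q * R"
proof -
  obtain Q R where QR: "Q \<in> O_group n" "R \<in> pos_upper n" "A = Q * R"
    using QR_exists[OF assms] by blast
  \<comment> \<open>The projections match the form into which \<open>case_prod_unfold\<close> turns
    the pair pattern of the goal.\<close>
  have "\<exists>!p. fst p \<in> O_group n \<and> snd p \<in> pos_upper n \<and> A = fst p * snd p"
  proof (rule ex1I[of _ "(Q, R)"])
    fix p :: "real mat \<times> real mat"
    assume p: "fst p \<in> O_group n \<and> snd p \<in> pos_upper n \<and> A = fst p * snd p"
    then have "fst p * snd p = Q * R"
      using QR(3) by (elim conjE) (rule trans[OF sym])
    then show "p = (Q, R)"
      using QR_unique[of "fst p" n "snd p" Q R] p QR(1,2) by (intro prod_eqI) auto
  next
    show "fst (Q, R) \<in> O_group n \<and> snd (Q, R) \<in> pos_upper n \<and> A = fst (Q, R) * snd (Q, R)"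
      unfolding fst_conv snd_conv using QR by (intro conjI)
  qed
  then show ?thesis
    by (simp only: pos_upper_def mem_Collect_eq case_prod_unfold conj_assoc)
qed

end
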